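(* Suppose that the transition densities $(p^Z_t)_{0<t\le T}$ satisfy the following properties: (i) for all $0<t\le T$, the function $(x,y)\mapsto p^Z_t(x,y)$ is continuous; (ii) for all $x,z\in E$ and all $s,t>0$ with $s+t\le T$, the Kolmogorov-Chapman equation $p^Z_{s+t}(x,z)=\int_E p^Z_s(x,y)\,p^Z_t(y,z)\,\lambda(dy)$ holds; (iii) for all $x\in E$ and all $0<t\le T$, we have $p^Z_t(x,b)>0$. Let $p_{s,t}$, $0\le s<t<T$, be the functions associated with $Z$, $b$ and $T$ as defined in the context. Then $$p_{s,t}(x,y)=\frac{p^Z_{t-s}(x,y)\,p^Z_{T-t}(y,b)}{p^Z_{T-s}(x,b)},\qquad x,y\in E,\quad 0\le s<t<T,$$ and the functions $(p_{s,t})_{0\le s<t<T}$ satisfy the following conditions: for all $0\le s<t<T$, the function $(x,y)\mapsto p_{s,t}(x,y)$ is measurable; for all $x\in E$ and $0\le s<t<T$, the function $y\mapsto p_{s,t}(x,y)$ is a probability density (with respect to $\lambda$); and for all $x,z\in E$ and $0\le s<t<u<T$, the Kolmogorov-Chapman equation $$p_{s,u}(x,z)=\int_E p_{s,t}(x,y)\,p_{t,u}(y,z)\,\lambda(dy)$$ holds.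
   Context: Let $E$ be a complete separable metric space endowed with its Borel $\sigma$-algebra $\mathcal{E}$, let $T>0$, let $b\in E$, and let $\lambda$ be a fixed $\sigma$-finite measure on $\mathcal{E}$. For $\varepsilon>0$, $B(b,\varepsilon)$ denotes the open ball in $E$ with centre $b$ and radius $\varepsilon$. Let $(Z_t)_{0\le t\le T}$ be a time-homogeneous Markov process with state space $(E,\mathcal{E})$ admitting transition densities $(p^Z_t)_{0<t\le T}$ with respect to $\lambda$, i.e. $\mathsf{P}(Z_t\in A\mid Z_s)=\int_A p^Z_{t-s}(Z_s,y)\,\lambda(dy)$ $\mathsf{P}$-a.s. for all $A\in\mathcal{E}$, $0\le s<t\le T$. For $x,y\in E$ and $0\le s<t<T$ define $$p_{s,t}(x,y):=p^Z_{t-s}(x,y)\lim_{\varepsilon\downarrow0}\frac{\int_{B(b,\varepsilon)}p^Z_{T-t}(y,z)\,\lambda(dz)}{\int_{B(b,\varepsilon)}p^Z_{T-s}(x,z)\,\lambda(dz)}$$ if the right hand side exists, and $p_{s,t}(x,y):=0$ otherwise.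
   Formalization: It is additionally assumed that every open ball B(b,ε), ε>0, has positive λ-measure; otherwise the quotient defining p_{s,t} is 0/0 for small ε, so p_{s,t}=0 and the claimed formula fails at y=b. *)

theory Defs
  imports "HOL-Probability.Probability"
begin

text \<open>
  \<open>M\<close> is the underlying probability space, \<open>E\<close> is the type \<open>'a\<close> with its Borel
  \<open>\<sigma>\<close>-algebra, and \<open>\<nu>\<close> is the \<open>\<sigma>\<close>-finite reference measure.
  All functions indexed by time are total; only their values at the times mentioned in the
  definitions matter.
\<close>

definition generated_by :: "'w measure \<Rightarrow> (real \<Rightarrow> 'w \<Rightarrow> 'a::topological_space) \<Rightarrow> real set \<Rightarrow> 'w measure"
  where "generated_by M Z I =
    sigma (space M) {Z r -` A \<inter> space M | r A. r \<in> I \<and> A \<in> sets borel}"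

definition markov_process :: "'w measure \<Rightarrow> real \<Rightarrow> (real \<Rightarrow> 'w \<Rightarrow> 'a::topological_space) \<Rightarrow> bool"
  where "markov_process M T Z \<longleftrightarrow>
    prob_space M \<and>
    (\<forall>t\<in>{0..T}. Z t \<in> borel_measurable M) \<and>
    (\<forall>s t. \<forall>A\<in>sets borel. 0 \<le> s \<longrightarrow> s < t \<longrightarrow> t \<le> T \<longrightarrow>
      (AE w in M. nn_cond_exp M (generated_by M Z {0..s}) (indicator (Z t -` A \<inter> space M)) w
                = nn_cond_exp M (generated_by M Z {s}) (indicator (Z t -` A \<inter> space M)) w))"

text \<open>
  Time-homogeneity is expressed by the density depending on \<open>s\<close> and \<open>t\<close> only through \<open>t - s\<close>.
\<close>

definition transition_densities ::
    "'w measure \<Rightarrow> real \<Rightarrow> (real \<Rightarrow> 'w \<Rightarrow> 'a::topological_space) \<Rightarrow> 'a measure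
      \<Rightarrow> (real \<Rightarrow> 'a \<Rightarrow> 'a \<Rightarrow> real) \<Rightarrow> bool"
  where "transition_densities M T Z \<nu> p \<longleftrightarrow>
    (\<forall>t. 0 < t \<longrightarrow> t \<le> T \<longrightarrow>
      (\<lambda>(x, y). p t x y) \<in> borel_measurable (borel \<Otimes>\<^sub>M borel) \<and> (\<forall>x y. 0 \<le> p t x y)) \<and>
    (\<forall>s t. \<forall>A\<in>sets borel. 0 \<le> s \<longrightarrow> s < t \<longrightarrow> t \<le> T \<longrightarrow>
      (AE w in M. nn_cond_exp M (generated_by M Z {s}) (indicator (Z t -` A \<inter> space M)) w
                = (\<integral>\<^sup>+y\<in>A. ennreal (p (t - s) (Z s w) y) \<partial>\<nu>)))"

definition bridge_ratio ::
    "real \<Rightarrow> 'a::metric_space \<Rightarrow> 'a measure \<Rightarrow> (real \<Rightarrow> 'a \<Rightarrow> 'a \<Rightarrow> real)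
      \<Rightarrow> real \<Rightarrow> real \<Rightarrow> 'a \<Rightarrow> 'a \<Rightarrow> real \<Rightarrow> real"
  where "bridge_ratio T b \<nu> p s t x y \<epsilon> =
    (LINT z:ball b \<epsilon>|\<nu>. p (T - t) y z) / (LINT z:ball b \<epsilon>|\<nu>. p (T - s) x z)"

text \<open>
  The guard excludes the conventional values which HOL assigns to integrals of non-integrable
  functions and to division by zero: the limit exists if, for all sufficiently small \<open>\<epsilon>\<close>, both
  integrals are finite and the denominator is nonzero, and the quotients converge in the reals.
\<close>

definition bridge_limit_exists ::
    "real \<Rightarrow> 'a::metric_space \<Rightarrow> 'a measure \<Rightarrow> (real \<Rightarrow> 'a \<Rightarrow> 'a \<Rightarrow> real)
      \<Rightarrow> real \<Rightarrow> real \<Rightarrow> 'a \<Rightarrow> 'a \<Rightarrow> bool"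
  where "bridge_limit_exists T b \<nu> p s t x y \<longleftrightarrow>
    (\<forall>\<^sub>F \<epsilon> in at_right 0.
       set_integrable \<nu> (ball b \<epsilon>) (p (T - t) y) \<and>
       set_integrable \<nu> (ball b \<epsilon>) (p (T - s) x) \<and>
       (LINT z:ball b \<epsilon>|\<nu>. p (T - s) x z) \<noteq> 0) \<and>
    (\<exists>l. (bridge_ratio T b \<nu> p s t x y \<longlongrightarrow> l) (at_right 0))"

definition bridge_density ::
    "real \<Rightarrow> 'a::metric_space \<Rightarrow> 'a measure \<Rightarrow> (real \<Rightarrow> 'a \<Rightarrow> 'a \<Rightarrow> real)
      \<Rightarrow> real \<Rightarrow> real \<Rightarrow> 'a \<Rightarrow> 'a \<Rightarrow> real"
  where "bridge_density T b \<nu> p s t x y =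
    (if bridge_limit_exists T b \<nu> p s t x y
     then p (t - s) x y * Lim (at_right 0) (bridge_ratio T b \<nu> p s t x y)
     else 0)"

definition is_probability_density :: "'a measure \<Rightarrow> ('a \<Rightarrow> real) \<Rightarrow> bool"
  where "is_probability_density \<nu> f \<longleftrightarrow>
    f \<in> borel_measurable \<nu> \<and> (\<forall>y\<in>space \<nu>. 0 \<le> f y) \<and> (\<integral>\<^sup>+y. ennreal (f y) \<partial>\<nu>) = 1"

end

theory Submission
  imports Defs
begin

text \<open>
  The limit defining the bridge density is a quotient of two integrals over shrinking balls around
  \<open>b\<close>. Dividing both by the measure of the ball turns them into averages, and averages of a
  function continuous at \<open>b\<close> converge to its value at \<open>b\<close>; since \<open>p (T - s) x b > 0\<close>, the
  quotient converges to \<open>p (T - t) y b / p (T - s) x b\<close> (\<open>ball_integral_quotient_tendsto\<close>).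

  This argument needs small balls around \<open>b\<close> to have finite measure, which \<open>\<sigma>\<close>-finiteness
  alone does not give. It follows from the Kolmogorov-Chapman equation: for \<open>r = T / 2\<close> the function
  \<open>y \<mapsto> p r b y * p r y b\<close> is continuous, positive at \<open>b\<close>, and has finite integral \<open>p T b b\<close>,
  so a ball on which it stays away from zero must have finite measure
  (\<open>eventually_finite_ball\<close>).

  Thus the bridge density is the Doob transform \<open>p (t - s) x y * h t y / h s x\<close> of \<open>p\<close> by the
  space-time harmonic function \<open>h t y = p (T - t) y b\<close>. The total mass is one because the
  Kolmogorov-Chapman equation with terminal point \<open>b\<close> says that \<open>h\<close> is harmonic, and in the
  product of two bridge densities the factor \<open>h t y\<close> at the intermediate point cancels, which
  reduces the Kolmogorov-Chapman equation for the bridge to the one for \<open>p\<close>.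
\<close>

text \<open>Continuity at \<open>b\<close> bounds \<open>h\<close> below near \<open>b\<close>, and Markov's inequality does the rest.\<close>

lemma eventually_finite_ball:
  fixes h :: "'a::metric_space \<Rightarrow> real"
  assumes sets: "sets \<nu> = sets borel"
    and meas: "h \<in> borel_measurable borel" and cont: "isCont h b" and pos: "0 < h b"
    and fin: "(\<integral>\<^sup>+y. ennreal (h y) \<partial>\<nu>) < \<infinity>"
  shows "\<forall>\<^sub>F \<epsilon> in at_right 0. emeasure \<nu> (ball b \<epsilon>) < \<infinity>"
proof -
  define c where "c = h b / 2"
  have c: "0 < c" "c < h b" using pos by (auto simp: c_def)
  have "\<forall>\<^sub>F y in nhds b. c < h y"
    using cont c(2) by (auto simp: isCont_def tendsto_at_iff_tendsto_nhds intro: order_tendstoD)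
  then obtain d where d: "0 < d" "\<And>y. dist y b < d \<Longrightarrow> c < h y"
    by (auto simp: eventually_nhds_metric)
  have hm [measurable]: "h \<in> borel_measurable \<nu>"
    using meas measurable_cong_sets[OF sets refl] by blast
  have "emeasure \<nu> (ball b \<epsilon>) < \<infinity>" if "\<epsilon> < d" for \<epsilon>
  proof -
    have [measurable]: "ball b \<epsilon> \<in> sets \<nu>" by (simp add: sets)
    have "ennreal c * emeasure \<nu> (ball b \<epsilon>) = (\<integral>\<^sup>+y. ennreal c * indicator (ball b \<epsilon>) y \<partial>\<nu>)"
      by (simp add: nn_integral_cmult_indicator)
    also have "\<dots> \<le> (\<integral>\<^sup>+y. ennreal (h y) \<partial>\<nu>)"
    proof (rule nn_integral_mono)
      fix y show "ennreal c * indicator (ball b \<epsilon>) y \<le> ennreal (h y)"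
      proof (cases "y \<in> ball b \<epsilon>")
        case True
        then have "c < h y" using d(2)[of y] that by (simp add: dist_commute)
        then show ?thesis using True by (simp add: ennreal_leI)
      qed simp
    qed
    finally have "ennreal c * emeasure \<nu> (ball b \<epsilon>) < \<infinity>" using fin by (rule le_less_trans)
    then show ?thesis using c by (auto simp: ennreal_mult_less_top)
  qed
  then show ?thesis
    using d(1) by (auto simp: eventually_at_right_field)
qed

text \<open>
  A function continuous at \<open>b\<close> differs from its value at \<open>b\<close> by at most \<open>e\<close> on all small
  balls. Applied with \<open>e = 1\<close> this gives integrability, and with arbitrary \<open>e\<close> the convergence of the
  averages.
\<close>

lemma ball_integral_near_centre:
  fixes f :: "'a::metric_space \<Rightarrow> real"
  assumes sets: "sets \<nu> = sets borel"
    and fin: "\<forall>\<^sub>F \<epsilon> in at_right 0. emeasure \<nu> (ball b \<epsilon>) < \<infinity>"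
    and meas: "f \<in> borel_measurable borel" and cont: "isCont f b" and e: "0 < e"
  shows "\<forall>\<^sub>F \<epsilon> in at_right 0. set_integrable \<nu> (ball b \<epsilon>) f \<and>
    \<bar>(LINT z:ball b \<epsilon>|\<nu>. f z) - f b * measure \<nu> (ball b \<epsilon>)\<bar> \<le> e * measure \<nu> (ball b \<epsilon>)"
proof -
  have "\<forall>\<^sub>F y in nhds b. dist (f y) (f b) < e"
    using cont e by (auto simp: isCont_def tendsto_at_iff_tendsto_nhds intro: tendstoD)
  then obtain d where d: "0 < d" "\<And>y. dist y b < d \<Longrightarrow> dist (f y) (f b) < e"
    by (auto simp: eventually_nhds_metric)
  have fm [measurable]: "f \<in> borel_measurable \<nu>"
    using meas measurable_cong_sets[OF sets refl] by blast
  have "\<forall>\<^sub>F \<epsilon> in at_right (0::real). \<epsilon> < d"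
    using d(1) by (auto simp: eventually_at_right_field)
  with fin show ?thesis
  proof eventually_elim
    case (elim \<epsilon>)
    let ?B = "ball b \<epsilon>"
    have B [measurable]: "?B \<in> sets \<nu>" by (simp add: sets)
    have near: "\<bar>f y - f b\<bar> \<le> e" if "y \<in> ?B" for y
      using d(2)[of y] that elim(2) by (simp add: dist_commute dist_real_def)
    have const: "set_integrable \<nu> ?B (\<lambda>_. c)" for c :: real
      using elim(1) by (auto simp: set_integrable_def)
    have diff: "set_integrable \<nu> ?B (\<lambda>y. f y - f b)"
      unfolding set_integrable_def
    proof (rule Bochner_Integration.integrable_bound)
      show "integrable \<nu> (\<lambda>y. indicator ?B y *\<^sub>R e)"
        using const[of e] by (simp add: set_integrable_def)
      show "(\<lambda>y. indicator ?B y *\<^sub>R (f y - f b)) \<in> borel_measurable \<nu>" by measurable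
    qed (use near e in \<open>auto simp: indicator_def\<close>)
    have int: "set_integrable \<nu> ?B f"
      using set_integral_add(1)[OF diff const[of "f b"]] by simp
    have const_eq: "(LINT y:?B|\<nu>. c) = c * measure \<nu> ?B" for c :: real
      using elim(1) B by (simp add: set_lebesgue_integral_def)
    have "\<bar>LINT y:?B|\<nu>. f y - f b\<bar> \<le> (LINT y:?B|\<nu>. e)"
      unfolding set_lebesgue_integral_def real_norm_def[symmetric]
    proof (rule order_trans[OF integral_norm_bound integral_mono'])
      show "integrable \<nu> (\<lambda>y. indicator ?B y *\<^sub>R e)"
        using const[of e] by (simp add: set_integrable_def)
    qed (use near e in \<open>auto simp: indicator_def\<close>)
    moreover have "(LINT y:?B|\<nu>. f y - f b) = (LINT y:?B|\<nu>. f y) - f b * measure \<nu> ?B"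
      using set_integral_diff(2)[OF int const[of "f b"]] const_eq by simp
    ultimately show ?case using int const_eq by simp
  qed
qed

lemma ball_average_tendsto:
  fixes f :: "'a::metric_space \<Rightarrow> real"
  assumes sets: "sets \<nu> = sets borel"
    and pos: "\<forall>\<epsilon>>0. 0 < emeasure \<nu> (ball b \<epsilon>)"
    and fin: "\<forall>\<^sub>F \<epsilon> in at_right 0. emeasure \<nu> (ball b \<epsilon>) < \<infinity>"
    and meas: "f \<in> borel_measurable borel" and cont: "isCont f b"
  shows "((\<lambda>\<epsilon>. (LINT z:ball b \<epsilon>|\<nu>. f z) / measure \<nu> (ball b \<epsilon>)) \<longlongrightarrow> f b) (at_right 0)"
proof (rule tendstoI)
  fix e :: real assume "0 < e"
  then have "\<forall>\<^sub>F \<epsilon> in at_right 0. set_integrable \<nu> (ball b \<epsilon>) f \<and>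
    \<bar>(LINT z:ball b \<epsilon>|\<nu>. f z) - f b * measure \<nu> (ball b \<epsilon>)\<bar> \<le> e / 2 * measure \<nu> (ball b \<epsilon>)"
    by (intro ball_integral_near_centre[OF sets fin meas cont]) simp
  with fin eventually_at_right_less[of 0]
  show "\<forall>\<^sub>F \<epsilon> in at_right 0. dist ((LINT z:ball b \<epsilon>|\<nu>. f z) / measure \<nu> (ball b \<epsilon>)) (f b) < e"
  proof eventually_elim
    case (elim \<epsilon>)
    define m where "m = measure \<nu> (ball b \<epsilon>)"
    define I where "I = (LINT z:ball b \<epsilon>|\<nu>. f z)"
    have m: "0 < m"
      using pos elim(1,2) by (simp add: m_def measure_def enn2real_positive_iff)
    have "\<bar>I / m - f b\<bar> = \<bar>I - f b * m\<bar> / m"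
      using m by (simp add: field_simps abs_divide flip: abs_mult)
    also have "\<dots> \<le> e / 2"
      using elim(3) m by (simp add: divide_le_eq I_def m_def)
    finally show ?case using \<open>0 < e\<close> by (simp add: dist_real_def I_def m_def)
  qed
qed

text \<open>
  The measure of the ball cancels from the quotient of the two averages; as the limit of the
  denominators is positive, they are eventually nonzero.
\<close>

lemma ball_integral_quotient_tendsto:
  fixes f g :: "'a::metric_space \<Rightarrow> real"
  assumes sets: "sets \<nu> = sets borel"
    and pos: "\<forall>\<epsilon>>0. 0 < emeasure \<nu> (ball b \<epsilon>)"
    and fin: "\<forall>\<^sub>F \<epsilon> in at_right 0. emeasure \<nu> (ball b \<epsilon>) < \<infinity>"
    and f: "f \<in> borel_measurable borel" "isCont f b"
    and g: "g \<in> borel_measurable borel" "isCont g b" "0 < g b"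
  shows "((\<lambda>\<epsilon>. (LINT z:ball b \<epsilon>|\<nu>. f z) / (LINT z:ball b \<epsilon>|\<nu>. g z)) \<longlongrightarrow> f b / g b) (at_right 0)"
    and "\<forall>\<^sub>F \<epsilon> in at_right 0. (LINT z:ball b \<epsilon>|\<nu>. g z) \<noteq> 0"
proof -
  note avg = ball_average_tendsto[OF sets pos fin]
  have nz: "\<forall>\<^sub>F \<epsilon> in at_right 0. 0 < (LINT z:ball b \<epsilon>|\<nu>. g z) / measure \<nu> (ball b \<epsilon>)"
    using order_tendstoD(1)[OF avg[OF g(1,2)] g(3)] by simp
  then show "\<forall>\<^sub>F \<epsilon> in at_right 0. (LINT z:ball b \<epsilon>|\<nu>. g z) \<noteq> 0"
    by eventually_elim auto
  have "((\<lambda>\<epsilon>. ((LINT z:ball b \<epsilon>|\<nu>. f z) / measure \<nu> (ball b \<epsilon>)) /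
      ((LINT z:ball b \<epsilon>|\<nu>. g z) / measure \<nu> (ball b \<epsilon>))) \<longlongrightarrow> f b / g b) (at_right 0)"
    using g(3) by (intro tendsto_divide avg f g(1,2)) auto
  then show "((\<lambda>\<epsilon>. (LINT z:ball b \<epsilon>|\<nu>. f z) / (LINT z:ball b \<epsilon>|\<nu>. g z)) \<longlongrightarrow> f b / g b) (at_right 0)"
  proof (rule Lim_transform_eventually)
    show "\<forall>\<^sub>F \<epsilon> in at_right 0.
      ((LINT z:ball b \<epsilon>|\<nu>. f z) / measure \<nu> (ball b \<epsilon>)) / ((LINT z:ball b \<epsilon>|\<nu>. g z) / measure \<nu> (ball b \<epsilon>))
        = (LINT z:ball b \<epsilon>|\<nu>. f z) / (LINT z:ball b \<epsilon>|\<nu>. g z)"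
      using nz by eventually_elim auto
  qed
qed

lemma bridge_density_eq:
  fixes p :: "real \<Rightarrow> 'a::metric_space \<Rightarrow> 'a \<Rightarrow> real"
  assumes sets: "sets \<nu> = sets borel"
    and pos: "\<forall>\<epsilon>>0. 0 < emeasure \<nu> (ball b \<epsilon>)"
    and fin: "\<forall>\<^sub>F \<epsilon> in at_right 0. emeasure \<nu> (ball b \<epsilon>) < \<infinity>"
    and y: "p (T - t) y \<in> borel_measurable borel" "isCont (p (T - t) y) b"
    and x: "p (T - s) x \<in> borel_measurable borel" "isCont (p (T - s) x) b" "0 < p (T - s) x b"
  shows "bridge_density T b \<nu> p s t x y = p (t - s) x y * p (T - t) y b / p (T - s) x b"
proof -
  have lim: "(bridge_ratio T b \<nu> p s t x y \<longlongrightarrow> p (T - t) y b / p (T - s) x b) (at_right 0)"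
    using ball_integral_quotient_tendsto(1)[OF sets pos fin y x]
    by (simp add: bridge_ratio_def[abs_def])
  have int: "\<forall>\<^sub>F \<epsilon> in at_right 0. set_integrable \<nu> (ball b \<epsilon>) f"
    if "f \<in> borel_measurable borel" "isCont f b" for f :: "'a \<Rightarrow> real"
    using ball_integral_near_centre[OF sets fin that, of 1] by (simp add: eventually_conj_iff)
  have "bridge_limit_exists T b \<nu> p s t x y"
    unfolding bridge_limit_exists_def
    using int[OF y] int[OF x(1,2)] ball_integral_quotient_tendsto(2)[OF sets pos fin y x] lim
    by (auto simp: eventually_conj_iff)
  moreover have "Lim (at_right 0) (bridge_ratio T b \<nu> p s t x y) = p (T - t) y b / p (T - s) x b"
    using lim by (intro tendsto_Lim) simp_all
  ultimately show ?thesis by (simp add: bridge_density_def)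
qed

theorem lemma2p5:
  fixes M :: "'w measure"
    and Z :: "real \<Rightarrow> 'w \<Rightarrow> 'a::polish_space"
    and \<nu> :: "'a measure"
    and T :: real
    and b :: 'a
    and p :: "real \<Rightarrow> 'a \<Rightarrow> 'a \<Rightarrow> real"
  assumes "0 < T"
    and "sets \<nu> = sets borel" and "sigma_finite_measure \<nu>"
    and "\<And>\<epsilon>. 0 < \<epsilon> \<Longrightarrow> 0 < emeasure \<nu> (ball b \<epsilon>)"
    and "markov_process M T Z"
    and "transition_densities M T Z \<nu> p"
    and i: "\<And>t. 0 < t \<Longrightarrow> t \<le> T \<Longrightarrow> continuous_on UNIV (\<lambda>(x, y). p t x y)"
    and ii: "\<And>x z s t. 0 < s \<Longrightarrow> 0 < t \<Longrightarrow> s + t \<le> T \<Longrightarrow>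
      ennreal (p (s + t) x z) = (\<integral>\<^sup>+y. ennreal (p s x y * p t y z) \<partial>\<nu>)"
    and iii: "\<And>x t. 0 < t \<Longrightarrow> t \<le> T \<Longrightarrow> 0 < p t x b"
  shows "(\<forall>x y s t. 0 \<le> s \<longrightarrow> s < t \<longrightarrow> t < T \<longrightarrow>
        bridge_density T b \<nu> p s t x y = p (t - s) x y * p (T - t) y b / p (T - s) x b)
    \<and> (\<forall>s t. 0 \<le> s \<longrightarrow> s < t \<longrightarrow> t < T \<longrightarrow>
        (\<lambda>(x, y). bridge_density T b \<nu> p s t x y) \<in> borel_measurable (borel \<Otimes>\<^sub>M borel))
    \<and> (\<forall>x s t. 0 \<le> s \<longrightarrow> s < t \<longrightarrow> t < T \<longrightarrow>
        is_probability_density \<nu> (\<lambda>y. bridge_density T b \<nu> p s t x y))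
    \<and> (\<forall>x z s t u. 0 \<le> s \<longrightarrow> s < t \<longrightarrow> t < u \<longrightarrow> u < T \<longrightarrow>
        ennreal (bridge_density T b \<nu> p s u x z)
          = (\<integral>\<^sup>+y. ennreal (bridge_density T b \<nu> p s t x y * bridge_density T b \<nu> p t u y z) \<partial>\<nu>))"
proof -
  have nonneg: "0 \<le> p t x y" if "0 < t" "t \<le> T" for t x y
    using assms(6) that by (auto simp: transition_densities_def)
  have sections: "continuous_on UNIV (p t x)" "continuous_on UNIV (\<lambda>x. p t x y)"
    if "0 < t" "t \<le> T" for t x y
    using continuous_on_compose2[OF i[OF that], of UNIV "\<lambda>y. (x, y)"]
      continuous_on_compose2[OF i[OF that], of UNIV "\<lambda>x. (x, y)"]
    by (auto simp: continuous_on_Pair)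
  have meas: "p t x \<in> borel_measurable borel" "(\<lambda>x. p t x y) \<in> borel_measurable borel"
    and cont: "isCont (p t x) b" "isCont (\<lambda>x. p t x y) b"
    if "0 < t" "t \<le> T" for t x y
    using sections[OF that]
    by (auto intro: borel_measurable_continuous_onI simp: continuous_on_eq_continuous_at)
  have meas_\<nu> [simp]: "f \<in> borel_measurable \<nu> \<longleftrightarrow> f \<in> borel_measurable borel" for f :: "'a \<Rightarrow> real"
    using measurable_cong_sets[OF assms(2) refl] by blast

  have pos: "\<forall>\<epsilon>>0. 0 < emeasure \<nu> (ball b \<epsilon>)" using assms(4) by simp
  have fin: "\<forall>\<^sub>F \<epsilon> in at_right 0. emeasure \<nu> (ball b \<epsilon>) < \<infinity>"
  proof (rule eventually_finite_ball[OF assms(2)])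
    have half: "0 < T / 2" "T / 2 \<le> T" using assms(1) by auto
    let ?h = "\<lambda>y. p (T / 2) b y * p (T / 2) y b"
    show "?h \<in> borel_measurable borel" using meas[OF half] by simp
    show "isCont ?h b" using cont[OF half] by (intro continuous_mult)
    show "0 < ?h b" using iii[OF half] by simp
    show "(\<integral>\<^sup>+y. ennreal (?h y) \<partial>\<nu>) < \<infinity>"
      using ii[OF half(1) half(1), of b b, symmetric] by simp
  qed
  have formula: "bridge_density T b \<nu> p s t x y = p (t - s) x y * p (T - t) y b / p (T - s) x b"
    if "0 \<le> s" "s < t" "t < T" for s t x y
    using that by (intro bridge_density_eq[OF assms(2) pos fin] meas cont iii) auto

  have measurable: "(\<lambda>(x, y). bridge_density T b \<nu> p s t x y) \<in> borel_measurable (borel \<Otimes>\<^sub>M borel)"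
    if st: "0 \<le> s" "s < t" "t < T" for s t
  proof -
    have [measurable]: "(\<lambda>(x, y). p (t - s) x y) \<in> borel_measurable (borel \<Otimes>\<^sub>M borel)"
      using assms(6) st by (auto simp: transition_densities_def)
    have [measurable]: "(\<lambda>y. p (T - t) y b) \<in> borel_measurable borel"
      "(\<lambda>x. p (T - s) x b) \<in> borel_measurable borel"
      using st by (auto intro: meas)
    show ?thesis unfolding formula[OF st] by measurable
  qed

  have density: "is_probability_density \<nu> (\<lambda>y. bridge_density T b \<nu> p s t x y)"
    if st: "0 \<le> s" "s < t" "t < T" for s t x
  proof -
    have h: "0 < p (T - s) x b" using st by (intro iii) auto
    have [measurable]: "p (t - s) x \<in> borel_measurable \<nu>" "(\<lambda>y. p (T - t) y b) \<in> borel_measurable \<nu>"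
      using st by (auto intro: meas)
    have nn: "0 \<le> p (t - s) x y * p (T - t) y b" for y
      using st by (intro mult_nonneg_nonneg nonneg) auto
    have "(\<integral>\<^sup>+y. ennreal (p (t - s) x y * p (T - t) y b / p (T - s) x b) \<partial>\<nu>)
        = (\<integral>\<^sup>+y. ennreal (p (t - s) x y * p (T - t) y b) / ennreal (p (T - s) x b) \<partial>\<nu>)"
      using h nn by (simp add: divide_ennreal)
    also have "\<dots> = (\<integral>\<^sup>+y. ennreal (p (t - s) x y * p (T - t) y b) \<partial>\<nu>) / ennreal (p (T - s) x b)"
      by (intro nn_integral_divide) measurable
    also have "\<dots> = ennreal (p (T - s) x b) / ennreal (p (T - s) x b)"
      using ii[of "t - s" "T - t" x b] st by simp
    also have "\<dots> = 1" using h by (simp add: divide_ennreal)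
    finally have mass: "(\<integral>\<^sup>+y. ennreal (p (t - s) x y * p (T - t) y b / p (T - s) x b) \<partial>\<nu>) = 1" .
    have "(\<lambda>y. p (t - s) x y * p (T - t) y b / p (T - s) x b) \<in> borel_measurable \<nu>"
      by measurable
    with mass show ?thesis
      using nn h by (simp add: is_probability_density_def formula[OF st] less_imp_le)
  qed

  have chapman: "ennreal (bridge_density T b \<nu> p s u x z)
      = (\<integral>\<^sup>+y. ennreal (bridge_density T b \<nu> p s t x y * bridge_density T b \<nu> p t u y z) \<partial>\<nu>)"
    if st: "0 \<le> s" "s < t" "t < u" "u < T" for s t u x z
  proof -
    define c where "c = p (T - u) z b / p (T - s) x b"
    have c: "0 \<le> c" unfolding c_def using st by (intro divide_nonneg_nonneg nonneg) auto
    have [measurable]: "p (t - s) x \<in> borel_measurable \<nu>" "(\<lambda>y. p (u - t) y z) \<in> borel_measurable \<nu>"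
      using st by (auto intro: meas)
    have "(\<integral>\<^sup>+y. ennreal (bridge_density T b \<nu> p s t x y * bridge_density T b \<nu> p t u y z) \<partial>\<nu>)
        = (\<integral>\<^sup>+y. ennreal c * ennreal (p (t - s) x y * p (u - t) y z) \<partial>\<nu>)"
    proof (rule nn_integral_cong)
      fix y
      \<comment> \<open>the weight at the intermediate point, which cancels\<close>
      have "p (T - t) y b \<noteq> 0" using iii[of "T - t" y] st by simp
      then have "bridge_density T b \<nu> p s t x y * bridge_density T b \<nu> p t u y z
          = c * (p (t - s) x y * p (u - t) y z)"
        using st by (simp add: formula c_def)
      then show "ennreal (bridge_density T b \<nu> p s t x y * bridge_density T b \<nu> p t u y z)
          = ennreal c * ennreal (p (t - s) x y * p (u - t) y z)"
        using c by (simp add: ennreal_mult')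
    qed
    also have "\<dots> = ennreal c * (\<integral>\<^sup>+y. ennreal (p (t - s) x y * p (u - t) y z) \<partial>\<nu>)"
      by (intro nn_integral_cmult) measurable
    also have "\<dots> = ennreal c * ennreal (p (u - s) x z)"
      using ii[of "t - s" "u - t" x z] st by simp
    also have "\<dots> = ennreal (bridge_density T b \<nu> p s u x z)"
      using st ennreal_mult'[OF c, symmetric] by (simp add: formula c_def mult_ac)
    finally show ?thesis by simp
  qed
  show ?thesis using formula measurable density chapman by blast
qed

end
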